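(* Let $\Omega\subset\mathbb{C}^n$ be a bounded domain. For each $\varepsilon>0$, there do not exist a continuous plurisubharmonic function $\rho<0$ on $\Omega$ and a constant $C_\varepsilon>0$ such that $$-\rho\le C_\varepsilon\,\delta_\Omega\left(1+|\log\delta_\Omega|\right)^{-\varepsilon}\quad\text{on }\Omega.$$
   Context: $\delta_\Omega(z)$ is the Euclidean distance from $z\in\Omega$ to $\partial\Omega$. *)

theory Defs
  imports "HOL-Analysis.Analysis"
begin

text \<open>Upper semicontinuity of \<open>u\<close> on \<open>U\<close>; the value \<open>-\<infinity>\<close> is allowed, \<open>\<infinity>\<close> is excluded.\<close>

definition usc_on :: "'a::topological_space set \<Rightarrow> ('a \<Rightarrow> ereal) \<Rightarrow> bool" where
  "usc_on U u \<longleftrightarrow>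
     (\<forall>z\<in>U. u z < \<infinity>) \<and> (\<forall>c. openin (top_of_set U) {z \<in> U. u z < c})"

text \<open>Mean value over the circle of centre \<open>a\<close> and radius \<open>r\<close>, as positive part minus negative
  part, because the library has no integral of \<open>ereal\<close>-valued functions. For \<open>u\<close> upper
  semicontinuous near the circle the first integral is finite, so the difference never has the
  form \<open>\<infinity> - \<infinity>\<close>; the mean may be \<open>-\<infinity>\<close>. Note that \<open>e2ennreal\<close> maps negative values to \<open>0\<close>.\<close>

definition circle_mean :: "(complex \<Rightarrow> ereal) \<Rightarrow> complex \<Rightarrow> real \<Rightarrow> ereal" where
  "circle_mean u a r =
     (enn2ereal (\<integral>\<^sup>+\<theta>\<in>{0..2 * pi}. e2ennreal (u (a + of_real r * cis \<theta>)) \<partial>lborel)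
      - enn2ereal (\<integral>\<^sup>+\<theta>\<in>{0..2 * pi}. e2ennreal (- u (a + of_real r * cis \<theta>)) \<partial>lborel))
     / ereal (2 * pi)"

text \<open>The function identically \<open>-\<infinity>\<close> counts as (pluri)subharmonic.\<close>

definition subharmonic_on :: "complex set \<Rightarrow> (complex \<Rightarrow> ereal) \<Rightarrow> bool" where
  "subharmonic_on U u \<longleftrightarrow>
     open U \<and> usc_on U u \<and>
     (\<forall>a r. 0 < r \<and> cball a r \<subseteq> U \<longrightarrow> u a \<le> circle_mean u a r)"

definition plurisubharmonic_on :: "(complex ^ 'n) set \<Rightarrow> (complex ^ 'n \<Rightarrow> ereal) \<Rightarrow> bool" where
  "plurisubharmonic_on \<Omega> u \<longleftrightarrow>
     open \<Omega> \<and> usc_on \<Omega> u \<and>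
     (\<forall>a b. subharmonic_on {\<zeta>. a + \<zeta> *s b \<in> \<Omega>} (\<lambda>\<zeta>. u (a + \<zeta> *s b)))"

text \<open>The norm of \<open>complex ^ 'n\<close> is the Euclidean one. \<open>infdist\<close> to the empty set is \<open>0\<close>, which does
  not occur for nonempty bounded \<open>\<Omega>\<close>.\<close>

definition boundary_dist :: "(complex ^ 'n) set \<Rightarrow> complex ^ 'n \<Rightarrow> real" where
  "boundary_dist \<Omega> z = infdist z (frontier \<Omega>)"

end

theory Submission imports Defs "HOL-Real_Asymp.Real_Asymp" begin

text \<open>A negative subharmonic function on a disc satisfies the Hopf lemma: it is at most a negative
  multiple of the boundary distance along a radius. Every bounded domain has a boundary point \<open>p\<close>
  that is nearest to some \<open>z0\<close> in the domain; on the complex line through \<open>z0\<close> and \<open>p\<close> the Hopf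
  lemma gives \<open>-\<rho> \<ge> c \<delta>\<close> on the segment from \<open>z0\<close> to \<open>p\<close>, which is incompatible with the
  logarithmic gain in the hypothesis.\<close>

section \<open>Circle means and a strict maximum principle\<close>

text \<open>Continuity on the circle makes the positive and negative parts finite, so the
  \<open>ereal\<close> difference is an ordinary real integral, open to the fundamental theorem of
  calculus and to integral comparison.\<close>

lemma circle_mean_ereal:
  fixes u :: "complex \<Rightarrow> real"
  assumes "0 \<le> r" and "continuous_on (sphere a r) u"
  shows "circle_mean (\<lambda>z. ereal (u z)) a r =
    ereal (integral {0..2 * pi} (\<lambda>\<theta>. u (a + of_real r * cis \<theta>)) / (2 * pi))"
proof -
  define g where "g \<theta> = u (a + of_real r * cis \<theta>)" for \<theta>
  have "continuous_on {0..2 * pi} g"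
    unfolding g_def using \<open>0 \<le> r\<close>
    by (intro continuous_on_compose2[OF assms(2)] continuous_intros)
       (auto simp: dist_norm norm_mult)
  then have int: "set_integrable lborel {0..2 * pi} g"
    by (rule borel_integrable_atLeastAtMost')
  define f where "f \<theta> = indicator {0..2 * pi} \<theta> * g \<theta>" for \<theta>
  have f: "integrable lborel f"
    using int by (simp add: f_def[abs_def] set_integrable_def)
  have pos: "(\<integral>\<^sup>+\<theta>\<in>{0..2 * pi}. e2ennreal (ereal (g \<theta>)) \<partial>lborel) = (\<integral>\<^sup>+\<theta>. ennreal (f \<theta>) \<partial>lborel)"
    and neg: "(\<integral>\<^sup>+\<theta>\<in>{0..2 * pi}. e2ennreal (- ereal (g \<theta>)) \<partial>lborel) = (\<integral>\<^sup>+\<theta>. ennreal (- f \<theta>) \<partial>lborel)"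
    by (auto intro!: nn_integral_cong simp: f_def indicator_def ennreal.abs_eq zero_ennreal_def[symmetric])
  have fin: "(\<integral>\<^sup>+\<theta>. ennreal (f \<theta>) \<partial>lborel) \<noteq> \<infinity>" "(\<integral>\<^sup>+\<theta>. ennreal (- f \<theta>) \<partial>lborel) \<noteq> \<infinity>"
    using f by (auto simp: real_integrable_def)
  have "integral\<^sup>L lborel f = integral {0..2 * pi} g"
    using set_borel_integral_eq_integral(2)[OF int]
    by (simp add: f_def[abs_def] set_lebesgue_integral_def)
  then have "enn2ereal (\<integral>\<^sup>+\<theta>. ennreal (f \<theta>) \<partial>lborel) - enn2ereal (\<integral>\<^sup>+\<theta>. ennreal (- f \<theta>) \<partial>lborel)
      = ereal (integral {0..2 * pi} g)"
    using real_lebesgue_integral_def[OF f] fin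
    by (cases "\<integral>\<^sup>+\<theta>. ennreal (f \<theta>) \<partial>lborel"; cases "\<integral>\<^sup>+\<theta>. ennreal (- f \<theta>) \<partial>lborel")
       (auto simp: enn2ereal_ennreal)
  then show ?thesis
    using pos neg by (simp add: circle_mean_def g_def[abs_def])
qed

text \<open>The coefficients make the Laplacian negative and the values nonnegative on the circle
  \<open>|z - 1/2| = 1/2\<close>, where \<open>(Im z)\<^sup>2 = Re z (1 - Re z)\<close>, as long as \<open>Re z \<ge> 4/5\<close>.\<close>

definition hopf_barrier :: "complex \<Rightarrow> real" where
  "hopf_barrier z = 2 * (Im z)\<^sup>2 - 3 * (1 - Re z)\<^sup>2 - (1 - Re z)"

lemma continuous_on_hopf_barrier [continuous_intros]: "continuous_on A hopf_barrier"
  unfolding hopf_barrier_def by (intro continuous_intros)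

text \<open>The barrier is a quadratic polynomial with Laplacian 4 - 6 = -2, so its circle mean is
  exactly the central value plus \<open>-2 * r\<^sup>2 / 4\<close>.\<close>

lemma hopf_barrier_circle_integral:
  "((\<lambda>\<theta>. hopf_barrier (a + of_real r * cis \<theta>)) has_integral
     2 * pi * (hopf_barrier a - r\<^sup>2 / 2)) {0..2 * pi}"
proof -
  \<comment> \<open>Termwise antiderivative of the barrier expanded along the circle; the quadratic
    part is rewritten by \<open>2 sin^2 - 3 cos^2 = -1/2 - 5/2 (cos^2 - sin^2)\<close>. Only the
    linear term changes over a full period.\<close>
  define F where "F \<theta> = (hopf_barrier a - r\<^sup>2 / 2) * \<theta> - 4 * r * Im a * cos \<theta>
    + r * (1 + 6 * (1 - Re a)) * sin \<theta> - 5 / 2 * r\<^sup>2 * (sin \<theta> * cos \<theta>)" for \<theta>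
  have "(F has_vector_derivative hopf_barrier (a + of_real r * cis \<theta>)) (at \<theta> within {0..2 * pi})" for \<theta>
  proof -
    have "(F has_real_derivative ((hopf_barrier a - r\<^sup>2 / 2) + 4 * r * Im a * sin \<theta>
        + r * (1 + 6 * (1 - Re a)) * cos \<theta> - 5 / 2 * r\<^sup>2 * ((cos \<theta>)\<^sup>2 - (sin \<theta>)\<^sup>2))) (at \<theta> within {0..2 * pi})"
      unfolding F_def by (auto intro!: derivative_eq_intros simp: power2_eq_square field_simps)
    also have "(hopf_barrier a - r\<^sup>2 / 2) + 4 * r * Im a * sin \<theta>
        + r * (1 + 6 * (1 - Re a)) * cos \<theta> - 5 / 2 * r\<^sup>2 * ((cos \<theta>)\<^sup>2 - (sin \<theta>)\<^sup>2)
        = hopf_barrier a + 4 * r * Im a * sin \<theta>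
        + r * (1 + 6 * (1 - Re a)) * cos \<theta> + r\<^sup>2 * (2 * (sin \<theta>)\<^sup>2 - 3 * (cos \<theta>)\<^sup>2)"
      unfolding sin_squared_eq by (simp add: field_simps)
    also have "\<dots> = hopf_barrier (a + of_real r * cis \<theta>)"
      by (simp add: hopf_barrier_def power2_eq_square algebra_simps)
    finally show ?thesis
      unfolding has_real_derivative_iff_has_vector_derivative .
  qed
  then have "((\<lambda>\<theta>. hopf_barrier (a + of_real r * cis \<theta>)) has_integral F (2 * pi) - F 0) {0..2 * pi}"
    by (intro fundamental_theorem_of_calculus) auto
  then show ?thesis
    by (simp add: F_def algebra_simps)
qed

text \<open>Subtracting a positive multiple of the superharmonic barrier makes the sub-mean value
  inequality strict, with a gain of \<open>\<kappa> * r\<^sup>2 / 2\<close>. This excludes a maximum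
  at the centre of a disc.\<close>

lemma subharmonic_on_barrier_no_max:
  fixes u :: "complex \<Rightarrow> real"
  assumes sub: "subharmonic_on U (\<lambda>z. ereal (u z))" and "\<kappa> > 0" and "r > 0"
    and U: "cball a r \<subseteq> U" and cont: "continuous_on (cball a r) u"
    and max: "\<And>z. z \<in> cball a r \<Longrightarrow> u z - \<kappa> * hopf_barrier z \<le> u a - \<kappa> * hopf_barrier a"
  shows False
proof -
  define M where "M = u a - \<kappa> * hopf_barrier a"
  have cs: "continuous_on (sphere a r) u"
    using cont by (rule continuous_on_subset) auto
  have in_sphere: "a + of_real r * cis \<theta> \<in> sphere a r" for \<theta>
    using \<open>r > 0\<close> by (simp add: dist_norm norm_mult)
  have "ereal (u a) \<le> circle_mean (\<lambda>z. ereal (u z)) a r"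
    using sub U \<open>r > 0\<close> unfolding subharmonic_on_def by blast
  then have "u a \<le> integral {0..2 * pi} (\<lambda>\<theta>. u (a + of_real r * cis \<theta>)) / (2 * pi)"
    using \<open>r > 0\<close> by (simp add: circle_mean_ereal[OF _ cs])
  \<comment> \<open>The maximality of \<open>a\<close>, integrated over the circle.\<close>
  moreover have "integral {0..2 * pi} (\<lambda>\<theta>. u (a + of_real r * cis \<theta>))
      \<le> \<kappa> * (2 * pi * (hopf_barrier a - r\<^sup>2 / 2)) + 2 * pi * M"
  proof (rule has_integral_le)
    have "continuous_on {0..2 * pi} (\<lambda>\<theta>. u (a + of_real r * cis \<theta>))"
      using in_sphere by (intro continuous_on_compose2[OF cs] continuous_intros) auto
    then show "((\<lambda>\<theta>. u (a + of_real r * cis \<theta>)) has_integral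
        integral {0..2 * pi} (\<lambda>\<theta>. u (a + of_real r * cis \<theta>))) {0..2 * pi}"
      by (intro integrable_integral integrable_continuous_interval)
    have "((\<lambda>\<theta>. M) has_integral 2 * pi * M) {0..2 * pi}"
      using has_integral_const_real[of M 0 "2 * pi"] by simp
    then show "((\<lambda>\<theta>. \<kappa> * hopf_barrier (a + of_real r * cis \<theta>) + M) has_integral
        \<kappa> * (2 * pi * (hopf_barrier a - r\<^sup>2 / 2)) + 2 * pi * M) {0..2 * pi}"
      by (intro has_integral_add has_integral_mult_right hopf_barrier_circle_integral)
    show "u (a + of_real r * cis \<theta>) \<le> \<kappa> * hopf_barrier (a + of_real r * cis \<theta>) + M" for \<theta>
      using max[of "a + of_real r * cis \<theta>"] in_sphere[of \<theta>] by (simp add: M_def)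
  qed
  ultimately have "u a * (2 * pi) \<le> \<kappa> * (2 * pi * (hopf_barrier a - r\<^sup>2 / 2)) + 2 * pi * M"
    by (simp add: pos_le_divide_eq)
  \<comment> \<open>By the choice of \<open>M\<close>, everything cancels except the deficit in the
    mean of the barrier.\<close>
  then have "(2 * pi) * (\<kappa> * r\<^sup>2 / 2) \<le> 0"
    by (simp add: M_def algebra_simps)
  moreover have "(2 * pi) * (\<kappa> * r\<^sup>2 / 2) > 0"
    using \<open>\<kappa> > 0\<close> \<open>r > 0\<close> by simp
  ultimately show False
    by simp
qed

section \<open>The Hopf lemma on the unit disc\<close>

lemma in_cball_half_iff: "z \<in> cball (1/2) (1/2) \<longleftrightarrow> (Im z)\<^sup>2 \<le> Re z * (1 - Re z)" for z :: complex
proof -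
  have "z \<in> cball (1/2) (1/2) \<longleftrightarrow> (norm (z - 1/2))\<^sup>2 \<le> (1/2)\<^sup>2"
    unfolding mem_cball dist_norm norm_minus_commute[of "1/2"]
    using abs_le_square_iff[of "norm (z - 1/2)" "1/2"] by simp
  also have "\<dots> \<longleftrightarrow> (Im z)\<^sup>2 \<le> Re z * (1 - Re z)"
    unfolding cmod_power2 by (auto simp: power2_eq_square field_simps)
  finally show ?thesis .
qed

lemma in_ball_half_iff: "z \<in> ball (1/2) (1/2) \<longleftrightarrow> (Im z)\<^sup>2 < Re z * (1 - Re z)" for z :: complex
proof -
  have "z \<in> ball (1/2) (1/2) \<longleftrightarrow> (norm (z - 1/2))\<^sup>2 < (1/2)\<^sup>2"
    unfolding mem_ball dist_norm norm_minus_commute[of "1/2"]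
    using abs_le_square_iff[of "1/2" "norm (z - 1/2)"] by (simp flip: not_le)
  also have "\<dots> \<longleftrightarrow> (Im z)\<^sup>2 < Re z * (1 - Re z)"
    unfolding cmod_power2 by (auto simp: power2_eq_square field_simps)
  finally show ?thesis .
qed

text \<open>The smaller circle touches the unit circle from inside: on its closed disc
  \<open>|z|^2 <= Re z <= 1\<close>, and \<open>Re z = 1\<close> forces
  \<open>z = 1\<close>.\<close>

lemma cball_half_subset_ball: "cball (1/2) (1/2) - {1} \<subseteq> ball (0::complex) 1"
proof
  fix z :: complex
  assume z: "z \<in> cball (1/2) (1/2) - {1}"
  then have *: "(Im z)\<^sup>2 \<le> Re z * (1 - Re z)" and "z \<noteq> 1"
    by (auto simp del: mem_cball simp: in_cball_half_iff)
  have "0 \<le> Re z * (1 - Re z)"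
    using * zero_le_power2[of "Im z"] by linarith
  then have "Re z \<le> 1"
    by (auto simp: zero_le_mult_iff)
  moreover have "Re z \<noteq> 1"
    using * \<open>z \<noteq> 1\<close> by (auto simp: complex_eq_iff)
  moreover have "(norm z)\<^sup>2 \<le> Re z"
    using * unfolding cmod_power2 by (simp add: power2_eq_square algebra_simps)
  ultimately have "(norm z)\<^sup>2 < 1"
    by simp
  then show "z \<in> ball 0 1"
    by (simp add: power_less_one_iff abs_square_less_1)
qed

text \<open>Maximum principle for \<open>u - \<kappa> * hopf_barrier\<close> on a cap at 1 of the
  smaller disc. The cap meets the unit circle only at 1, and there the sign of \<open>u\<close>
  replaces a boundary value.\<close>

lemma hopf_lemma_unit_disc:
  fixes u :: "complex \<Rightarrow> real"
  assumes sub: "subharmonic_on U (\<lambda>z. ereal (u z))" and U: "ball 0 1 \<subseteq> U"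
    and cont: "continuous_on (ball 0 1) u" and neg: "\<And>z. z \<in> ball 0 1 \<Longrightarrow> u z < 0"
  obtains \<kappa> where "\<kappa> > 0" and "\<And>t. 4/5 \<le> t \<Longrightarrow> t < 1 \<Longrightarrow> u (of_real t) \<le> - \<kappa> * (1 - t)"
proof -
  define K :: "complex set" where "K = cball (1/2) (1/2) \<inter> {z. 4/5 \<le> Re z}"
  have KI: "z \<in> K \<longleftrightarrow> (Im z)\<^sup>2 \<le> Re z * (1 - Re z) \<and> 4/5 \<le> Re z" for z
    using in_cball_half_iff[of z] by (simp add: K_def del: mem_cball)
  have K_ball: "K - {1} \<subseteq> ball 0 1"
    using cball_half_subset_ball by (auto simp: K_def simp del: mem_cball mem_ball)
  have "compact K"
    unfolding K_def by (intro compact_Int_closed compact_cball closed_halfspace_Re_ge)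
  \<comment> \<open>The flat side of the cap is compact inside the unit disc, so \<open>u\<close>
    has a negative maximum on it; this maximum fixes \<open>\<kappa>\<close>.\<close>
  define L where "L = K \<inter> {z. Re z = 4/5}"
  have "compact L"
    unfolding L_def by (intro compact_Int_closed \<open>compact K\<close> closed_Collect_eq continuous_intros)
  have "L \<subseteq> ball 0 1"
    using K_ball by (auto simp: L_def simp del: mem_ball)
  moreover have "4/5 \<in> L"
    by (simp add: L_def KI)
  ultimately obtain l where l: "l \<in> L" "\<And>z. z \<in> L \<Longrightarrow> u z \<le> u l"
    using continuous_attains_sup[OF \<open>compact L\<close>, of u] continuous_on_subset[OF cont] by blast
  define \<kappa> where "\<kappa> = - u l"
  have "\<kappa> > 0"
    using neg l(1) \<open>L \<subseteq> ball 0 1\<close> by (auto simp: \<kappa>_def simp del: mem_ball)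
  define w where "w z = u z - \<kappa> * hopf_barrier z" for z
  have w_le: "w z1 \<le> 0" if "z1 \<in> K - {1}" for z1
  proof (rule ccontr)
    assume "\<not> w z1 \<le> 0"
    \<comment> \<open>Nothing is known about \<open>u\<close> at 1, but \<open>u < 0\<close> gives
      \<open>w < - \<kappa> * hopf_barrier\<close>, which tends to 0 at 1. A positive value of
      \<open>w\<close> therefore stays above all values of \<open>w\<close> near 1, and the maximum
      can be sought on a compact set away from 1.\<close>
    have "((\<lambda>z. - \<kappa> * hopf_barrier z) \<longlongrightarrow> - \<kappa> * hopf_barrier 1) (nhds 1)"
      unfolding hopf_barrier_def by (intro tendsto_intros tendsto_Re tendsto_Im filterlim_ident)
    moreover have "- \<kappa> * hopf_barrier 1 < w z1"
      using \<open>\<not> w z1 \<le> 0\<close> by (simp add: hopf_barrier_def)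
    ultimately have "\<forall>\<^sub>F z in nhds 1. - \<kappa> * hopf_barrier z < w z1"
      by (rule order_tendstoD(2))
    then obtain d where "d > 0" and d: "\<And>z. dist z 1 < d \<Longrightarrow> - \<kappa> * hopf_barrier z < w z1"
      by (auto simp: eventually_nhds_metric)
    have near: "w z < w z1" if "z \<in> K - {1}" "dist z 1 < d" for z
    proof -
      have "u z < 0"
        using neg K_ball that(1) by blast
      then show ?thesis
        using d[OF that(2)] by (simp add: w_def)
    qed
    have "compact (K - ball 1 d)"
      by (intro compact_diff \<open>compact K\<close> open_ball)
    moreover have "K - ball 1 d \<subseteq> ball 0 1"
      using K_ball \<open>d > 0\<close> by (auto simp del: mem_ball simp: subset_iff)
    then have "continuous_on (K - ball 1 d) w"
      unfolding w_def by (intro continuous_intros continuous_on_subset[OF cont])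
    moreover have "z1 \<in> K - ball 1 d"
      using near[of z1] that by (auto simp: dist_commute)
    ultimately obtain a where a: "a \<in> K - ball 1 d" "\<And>z. z \<in> K - ball 1 d \<Longrightarrow> w z \<le> w a"
      using continuous_attains_sup[of "K - ball 1 d" w] by blast
    have a_max: "w z \<le> w a" if "z \<in> K - {1}" for z
      using a(2)[of z] a(2)[OF \<open>z1 \<in> K - ball 1 d\<close>] near[of z] that
      by (cases "dist z 1 < d") (auto simp: dist_commute)
    have "w a > 0"
      using a(2)[OF \<open>z1 \<in> K - ball 1 d\<close>] \<open>\<not> w z1 \<le> 0\<close> by simp
    have "a \<in> K - {1}"
      using a(1) \<open>d > 0\<close> by auto
    then have "u a < 0"
      using neg K_ball by blast
    then have "\<kappa> * hopf_barrier a < 0"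
      using \<open>w a > 0\<close> by (simp add: w_def)
    \<comment> \<open>This sign will keep \<open>a\<close> off the arc, where the barrier is
      nonnegative.\<close>
    then have h_neg: "hopf_barrier a < 0"
      using \<open>\<kappa> > 0\<close> by (simp add: mult_less_0_iff)
    have a_K: "(Im a)\<^sup>2 \<le> Re a * (1 - Re a)" "4/5 \<le> Re a"
      using \<open>a \<in> K - {1}\<close> by (auto simp: KI)
    \<comment> \<open>On the flat side \<open>u \<le> - \<kappa>\<close> and the barrier is at least
      -1, so \<open>w \<le> 0\<close>.\<close>
    have "Re a \<noteq> 4/5"
    proof
      assume Re: "Re a = 4/5"
      then have "u a \<le> - \<kappa>"
        using l(2)[of a] \<open>a \<in> K - {1}\<close> by (simp add: L_def \<kappa>_def)
      moreover have "hopf_barrier a = 2 * (Im a)\<^sup>2 - 8 / 25"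
        by (simp add: hopf_barrier_def Re power_divide)
      then have "hopf_barrier a \<ge> -1"
        using zero_le_power2[of "Im a"] by linarith
      then have "\<kappa> * hopf_barrier a \<ge> \<kappa> * (-1)"
        using \<open>\<kappa> > 0\<close> by (intro mult_left_mono) auto
      ultimately show False
        using \<open>w a > 0\<close> by (simp add: w_def)
    qed
    moreover have "(Im a)\<^sup>2 \<noteq> Re a * (1 - Re a)"
    proof
      assume Im: "(Im a)\<^sup>2 = Re a * (1 - Re a)"
      have "0 \<le> 1 - Re a"
        using Im a_K zero_le_power2[of "Im a"] by (auto simp: zero_le_mult_iff)
      then have "0 \<le> (1 - Re a) * (1 - 5 * (1 - Re a))"
        using a_K by simp
      also have "\<dots> = hopf_barrier a"
        unfolding hopf_barrier_def Im by (simp add: power2_eq_square algebra_simps)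
      finally show False
        using h_neg by simp
    qed
    \<comment> \<open>With both sides of the cap excluded, \<open>a\<close> is an interior
      maximum.\<close>
    ultimately have "a \<in> ball (1/2) (1/2) \<inter> {z. 4/5 < Re z}"
      using a_K in_ball_half_iff[of a] by (simp del: mem_ball)
    moreover have "open (ball (1/2) (1/2) \<inter> {z. 4/5 < Re z})"
      by (intro open_Int open_ball open_halfspace_Re_gt)
    ultimately obtain r where "r > 0" and r: "cball a r \<subseteq> ball (1/2) (1/2) \<inter> {z. 4/5 < Re z}"
      by (metis open_contains_cball)
    have "ball (1/2) (1/2) \<inter> {z. 4/5 < Re z} \<subseteq> K - {1}"
      by (auto simp: K_def dist_norm)
    with r have r_K: "cball a r \<subseteq> K - {1}"
      by (rule order_trans)
    then have r_ball: "cball a r \<subseteq> ball 0 1"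
      using K_ball by (rule order_trans)
    show False
    proof (rule subharmonic_on_barrier_no_max[OF sub \<open>\<kappa> > 0\<close> \<open>r > 0\<close>])
      show "cball a r \<subseteq> U"
        using r_ball U by (rule order_trans)
      show "continuous_on (cball a r) u"
        using cont r_ball by (rule continuous_on_subset)
      show "u z - \<kappa> * hopf_barrier z \<le> u a - \<kappa> * hopf_barrier a" if "z \<in> cball a r" for z
        using a_max[of z] r_K that by (auto simp: w_def simp del: mem_cball)
    qed
  qed
  show thesis
  proof
    show "\<kappa> > 0" by fact
    fix t :: real
    assume t: "4/5 \<le> t" "t < 1"
    then have "complex_of_real t \<in> K - {1}"
      by (auto simp: KI)
    then have "u (of_real t) \<le> \<kappa> * hopf_barrier (of_real t)"
      using w_le[of "of_real t"] by (simp add: w_def)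
    \<comment> \<open>On the real axis the barrier is \<open>-3 (1 - t)^2 - (1 - t)\<close>; its
      linear term is the Hopf slope.\<close>
    also have "\<dots> \<le> \<kappa> * - (1 - t)"
      using \<open>\<kappa> > 0\<close> by (intro mult_left_mono) (auto simp: hopf_barrier_def)
    finally show "u (of_real t) \<le> - \<kappa> * (1 - t)"
      by (simp add: algebra_simps)
  qed
qed

section \<open>A complex disc touching the boundary, and the contradiction\<close>

lemma norm_vector_scalar_mult_complex: "norm (c *s x) = norm c * norm x" for x :: "complex ^ 'n"
  by (simp add: norm_vec_def norm_mult L2_set_right_distrib)

text \<open>A ball is connected, so one that starts in \<open>S\<close> and leaves it meets the
  frontier, at a distance from \<open>x\<close> below the infimum.\<close>

lemma ball_infdist_frontier_subset:
  fixes S :: "'a::real_normed_vector set"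
  assumes "x \<in> S"
  shows "ball x (infdist x (frontier S)) \<subseteq> S"
proof (rule ccontr)
  assume "\<not> ?thesis"
  then obtain y where y: "y \<in> ball x (infdist x (frontier S))" "y \<notin> S"
    by blast
  then have "x \<in> ball x (infdist x (frontier S))"
    using le_less_trans[OF zero_le_dist] by simp
  then have "ball x (infdist x (frontier S)) \<inter> frontier S \<noteq> {}"
    using y assms by (intro connected_Int_frontier connected_ball) blast+
  then show False
    using infdist_le[of _ "frontier S" x] by force
qed

theorem theorem1p10:
  fixes \<Omega> :: "(complex ^ 'n) set" and \<epsilon> :: real
  assumes "open \<Omega>" and "connected \<Omega>" and "\<Omega> \<noteq> {}" and "bounded \<Omega>"
    and "\<epsilon> > 0"
  shows "\<not> (\<exists>(\<rho> :: complex ^ 'n \<Rightarrow> real) (C :: real).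
            continuous_on \<Omega> \<rho> \<and>
            plurisubharmonic_on \<Omega> (\<lambda>z. ereal (\<rho> z)) \<and>
            (\<forall>z\<in>\<Omega>. \<rho> z < 0) \<and>
            C > 0 \<and>
            (\<forall>z\<in>\<Omega>. - \<rho> z \<le> C * boundary_dist \<Omega> z *
                       (1 + \<bar>ln (boundary_dist \<Omega> z)\<bar>) powr (- \<epsilon>)))"
proof (intro notI, elim exE conjE)
  fix \<rho> :: "complex ^ 'n \<Rightarrow> real" and C :: real
  assume cont: "continuous_on \<Omega> \<rho>" and psh: "plurisubharmonic_on \<Omega> (\<lambda>z. ereal (\<rho> z))"
    and neg: "\<forall>z\<in>\<Omega>. \<rho> z < 0" and "C > 0"
    and bound: "\<forall>z\<in>\<Omega>. - \<rho> z \<le> C * boundary_dist \<Omega> z *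
      (1 + \<bar>ln (boundary_dist \<Omega> z)\<bar>) powr (- \<epsilon>)"
  obtain z0 where "z0 \<in> \<Omega>"
    using \<open>\<Omega> \<noteq> {}\<close> by blast
  have "frontier \<Omega> \<noteq> {}"
    using \<open>\<Omega> \<noteq> {}\<close> \<open>bounded \<Omega>\<close> by (auto simp: frontier_eq_empty)
  then obtain p where p: "p \<in> frontier \<Omega>" "infdist z0 (frontier \<Omega>) = dist z0 p"
    using infdist_attains_inf[OF frontier_closed] by blast
  define b where "b = p - z0"
  define R where "R = norm b"
  have "p \<notin> \<Omega>"
    using p(1) \<open>open \<Omega>\<close> by (simp add: frontier_def interior_open)
  then have "R > 0"
    using \<open>z0 \<in> \<Omega>\<close> by (auto simp: R_def b_def)
  \<comment> \<open>The unit disc is mapped into the ball about \<open>z0\<close> of radius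
    \<open>R\<close>, with 1 sent to \<open>p\<close>.\<close>
  have in_\<Omega>: "z0 + \<zeta> *s b \<in> \<Omega>" if "\<zeta> \<in> ball 0 1" for \<zeta>
  proof -
    have "dist z0 (z0 + \<zeta> *s b) < infdist z0 (frontier \<Omega>)"
      using that \<open>R > 0\<close> unfolding p(2)
      by (simp add: dist_norm norm_vector_scalar_mult_complex norm_minus_commute[of z0] R_def flip: b_def)
    then show ?thesis
      using ball_infdist_frontier_subset[OF \<open>z0 \<in> \<Omega>\<close>] by auto
  qed
  define u where "u \<zeta> = \<rho> (z0 + \<zeta> *s b)" for \<zeta>
  obtain \<kappa> where "\<kappa> > 0" and \<kappa>: "\<And>t. 4/5 \<le> t \<Longrightarrow> t < 1 \<Longrightarrow> u (of_real t) \<le> - \<kappa> * (1 - t)"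
  proof (rule hopf_lemma_unit_disc)
    show "subharmonic_on {\<zeta>. z0 + \<zeta> *s b \<in> \<Omega>} (\<lambda>\<zeta>. ereal (u \<zeta>))"
      using psh by (simp add: plurisubharmonic_on_def u_def)
    show "ball 0 1 \<subseteq> {\<zeta>. z0 + \<zeta> *s b \<in> \<Omega>}"
      using in_\<Omega> by blast
    show "u \<zeta> < 0" if "\<zeta> \<in> ball 0 1" for \<zeta>
      using in_\<Omega>[OF that] neg by (simp add: u_def)
    have "continuous_on (ball 0 1) (\<lambda>\<zeta>. z0 + \<zeta> *s b)"
      unfolding vector_scalar_mult_def by (intro continuous_intros continuous_on_vec_lambda)
    then show "continuous_on (ball 0 1) u"
      unfolding u_def using in_\<Omega> by (intro continuous_on_compose2[OF cont]) auto
  qed blast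
  \<comment> \<open>Here \<open>s\<close> is the distance to \<open>p\<close> along the radius. The
    bound \<open>R / 5\<close> gives \<open>t \<ge> 4/5\<close> for the Hopf estimate, and
    \<open>s < 1\<close> makes \<open>ln s\<close> negative.\<close>
  have lower: "\<kappa> / (R * C) \<le> (1 - ln s) powr (- \<epsilon>)" if "0 < s" "s < min 1 (R / 5)" for s
  proof -
    define t where "t = 1 - s / R"
    have t: "4/5 \<le> t" "t < 1"
      using that \<open>R > 0\<close> by (auto simp: t_def field_simps)
    define z where "z = z0 + of_real t *s b"
    have "z \<in> \<Omega>"
      unfolding z_def using t by (intro in_\<Omega>) auto
    define \<delta> where "\<delta> = boundary_dist \<Omega> z"
    have "\<delta> \<le> dist z p"
      unfolding \<delta>_def boundary_dist_def using p(1) by (rule infdist_le)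
    also have "z - p = of_real (t - 1) *s b"
      by (simp add: z_def b_def vec_eq_iff algebra_simps)
    then have "dist z p = s"
      using t that \<open>R > 0\<close> by (simp add: dist_norm norm_vector_scalar_mult_complex t_def norm_divide flip: R_def)
    finally have "\<delta> \<le> s" .
    have "\<delta> \<ge> 0"
      by (simp add: \<delta>_def boundary_dist_def infdist_nonneg)
    have main: "\<kappa> * (s / R) \<le> C * \<delta> * (1 + \<bar>ln \<delta>\<bar>) powr (- \<epsilon>)"
      using \<kappa>[OF t] bound \<open>z \<in> \<Omega>\<close> by (force simp: u_def t_def z_def \<delta>_def)
    moreover have "\<kappa> * (s / R) > 0"
      using \<open>\<kappa> > 0\<close> \<open>R > 0\<close> that by simp
    \<comment> \<open>At \<open>\<delta> = 0\<close> the right side of \<open>main\<close> would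
      vanish, whatever the default value of \<open>ln 0\<close>.\<close>
    ultimately have "\<delta> > 0"
      using \<open>\<delta> \<ge> 0\<close> by (cases "\<delta> = 0") auto
    have "ln \<delta> \<le> ln s" "ln s < 0"
      using \<open>\<delta> > 0\<close> \<open>\<delta> \<le> s\<close> that by auto
    \<comment> \<open>The exponent is negative and
      \<open>\<bar>ln \<delta>\<bar> \<ge> - ln s\<close>, so passing from \<open>\<delta>\<close>
      to \<open>s\<close> increases the logarithmic factor as well as the linear one.\<close>
    then have "(1 + \<bar>ln \<delta>\<bar>) powr (- \<epsilon>) \<le> (1 - ln s) powr (- \<epsilon>)"
      using \<open>\<epsilon> > 0\<close> by (intro powr_mono2') auto
    then have "C * \<delta> * (1 + \<bar>ln \<delta>\<bar>) powr (- \<epsilon>) \<le> C * s * (1 - ln s) powr (- \<epsilon>)"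
      using \<open>C > 0\<close> \<open>\<delta> > 0\<close> \<open>\<delta> \<le> s\<close> by (intro mult_mono) auto
    with main have "\<kappa> * (s / R) \<le> C * s * (1 - ln s) powr (- \<epsilon>)"
      by linarith
    then show ?thesis
      using \<open>C > 0\<close> \<open>R > 0\<close> \<open>0 < s\<close> by (simp add: field_simps)
  qed
  \<comment> \<open>After cancelling \<open>s\<close>, a fixed positive constant lies below a
    quantity that tends to 0.\<close>
  have "((\<lambda>s. (1 - ln s) powr (- \<epsilon>)) \<longlongrightarrow> 0) (at_right 0)"
    using \<open>\<epsilon> > 0\<close> by real_asymp
  moreover have "0 < min 1 (R / 5)"
    using \<open>R > 0\<close> by simp
  then have "\<forall>\<^sub>F s in at_right 0. \<kappa> / (R * C) \<le> (1 - ln s) powr (- \<epsilon>)"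
    using lower unfolding eventually_at_right_field by blast
  ultimately have "\<kappa> / (R * C) \<le> 0"
    by (rule tendsto_lowerbound) simp
  moreover have "\<kappa> / (R * C) > 0"
    using \<open>\<kappa> > 0\<close> \<open>R > 0\<close> \<open>C > 0\<close> by simp
  ultimately show False
    by simp
qed

end
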